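(* For each natural number $k$, the class of $\mathcal{A}$-free bipartite graphs of chordality at most $k$ is at most factorial.
   Context: Graphs are finite, simple and undirected. A graph is $H$-free if it contains no induced subgraph isomorphic to $H$. A bipartite graph has chordality at most $k$ if it has no chordless (induced) cycle of length greater than $k$. $\mathcal{A}$ is the graph on six vertices $l_1,l_2,l_3,r_1,r_2,r_3$ with edges $l_1l_2,\ l_2l_3,\ r_1r_2,\ r_2r_3,\ l_2r_2,\ l_3r_3$ (a $C_4$ with one pendant edge attached to each of two adjacent vertices). A hereditary class (one closed under taking induced subgraphs) is at most factorial if the number of labelled graphs in it with vertex set $\{1,\ldots,n\}$ is $2^{O(n\log n)}$. *)

theory Defs
  imports Complex_Main "HOL-Library.Landau_Symbols"
begin

type_synonym 'a ugraph = "'a set \<times> 'a set set"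

abbreviation verts :: "'a ugraph \<Rightarrow> 'a set" where
  "verts G \<equiv> fst G"

abbreviation edges :: "'a ugraph \<Rightarrow> 'a set set" where
  "edges G \<equiv> snd G"

definition simple_graph :: "'a ugraph \<Rightarrow> bool" where
  "simple_graph G \<longleftrightarrow> finite (verts G) \<and> (\<forall>e\<in>edges G. e \<subseteq> verts G \<and> card e = 2)"

definition induced_subgraph :: "'a ugraph \<Rightarrow> 'a set \<Rightarrow> 'a ugraph" where
  "induced_subgraph G S = (S, {e \<in> edges G. e \<subseteq> S})"

definition graph_iso :: "'a ugraph \<Rightarrow> 'b ugraph \<Rightarrow> bool" where
  "graph_iso G H \<longleftrightarrow> (\<exists>f. bij_betw f (verts G) (verts H) \<and>
     (\<forall>u\<in>verts G. \<forall>v\<in>verts G. {u, v} \<in> edges G \<longleftrightarrow> {f u, f v} \<in> edges H))"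

definition contains_induced :: "'a ugraph \<Rightarrow> 'b ugraph \<Rightarrow> bool" where
  "contains_induced G H \<longleftrightarrow> (\<exists>S\<subseteq>verts G. graph_iso (induced_subgraph G S) H)"

definition free_of :: "'a ugraph \<Rightarrow> 'b ugraph \<Rightarrow> bool" where
  "free_of G H \<longleftrightarrow> \<not> contains_induced G H"

definition bipartite :: "'a ugraph \<Rightarrow> bool" where
  "bipartite G \<longleftrightarrow> (\<exists>A B. A \<union> B = verts G \<and> A \<inter> B = {} \<and>
     (\<forall>e\<in>edges G. \<exists>a\<in>A. \<exists>b\<in>B. e = {a, b}))"

text \<open>The cycle of length \<open>m\<close>; meaningful only for \<open>m \<ge> 3\<close>.\<close>

definition cycle_graph :: "nat \<Rightarrow> nat ugraph" where
  "cycle_graph m = ({..<m}, {{i, Suc i mod m} | i. i < m})"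

definition chordality_at_most :: "nat \<Rightarrow> 'a ugraph \<Rightarrow> bool" where
  "chordality_at_most k G \<longleftrightarrow> (\<forall>m. m \<ge> 3 \<and> m > k \<longrightarrow> \<not> contains_induced G (cycle_graph m))"

datatype A_vertex = L1 | L2 | L3 | R1 | R2 | R3

definition graph_A :: "A_vertex ugraph" where
  "graph_A = ({L1, L2, L3, R1, R2, R3},
     {{L1, L2}, {L2, L3}, {R1, R2}, {R2, R3}, {L2, R2}, {L3, R3}})"

definition A_free_bipartite :: "nat \<Rightarrow> nat ugraph set" where
  "A_free_bipartite k = {G. simple_graph G \<and> bipartite G \<and> chordality_at_most k G \<and> free_of G graph_A}"

text \<open>Classes are sets of graphs whose vertices are natural numbers; every finite graph has
  an isomorphic copy of this kind.\<close>

definition hereditary :: "nat ugraph set \<Rightarrow> bool" where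
  "hereditary X \<longleftrightarrow> (\<forall>G\<in>X. \<forall>S\<subseteq>verts G. induced_subgraph G S \<in> X)"

definition labelled_graphs :: "nat ugraph set \<Rightarrow> nat \<Rightarrow> nat ugraph set" where
  "labelled_graphs X n = {G \<in> X. simple_graph G \<and> verts G = {1..n}}"

text \<open>The notion is defined for hereditary classes only, so heredity is part of it.\<close>

definition at_most_factorial :: "nat ugraph set \<Rightarrow> bool" where
  "at_most_factorial X \<longleftrightarrow> hereditary X \<and>
     (\<exists>f :: nat \<Rightarrow> real. f \<in> O(\<lambda>n. real n * ln (real n)) \<and>
        (\<forall>n. real (card (labelled_graphs X n)) \<le> 2 powr f n))"

end

theory Submission
  imports Defs
begin

text \<open>
  The counting principle is that a hereditary class is at most factorial as soon as, for some
  constant \<open>c\<close>, every nonempty graph in it has a vertex whose neighbourhood is known up to at most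
  \<open>c\<close> vertices: it differs in at most \<open>c\<close> places from the empty set or from the neighbourhood
  of another vertex. Deleting such a vertex from a graph on at most \<open>N\<close> vertices loses only a choice
  among \<open>N\<^sup>c\<^sup>+\<^sup>2\<close>, so by induction there are at most \<open>n\<close> to the power \<open>(c + 2) n\<close> labelled graphs on
  \<open>n\<close> vertices (\<open>at_most_factorialI\<close>). It remains to find such a vertex
  (\<open>A_free_exists_close_vertex\<close>), and there are three cases.

  If two vertices are twins, their neighbourhoods coincide. Suppose there are no twins, but two
  vertices have two common neighbours. In an \<open>\<A>\<close>-free bipartite graph the traces that neighbourhoods
  leave on a fixed neighbourhood \<open>N(b)\<close> are very restricted: two different traces that meet must
  together cover \<open>N(b)\<close>. In the absence of twins all vertices of \<open>N(b)\<close> are told apart by such traces,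
  and this forces two neighbourhoods with two common elements to differ by at most one element on
  either side (\<open>A_free_twin_free_close\<close>).

  Otherwise no two vertices have two common neighbours, and the claim is that bounded chordality
  forces a vertex of bounded degree. Suppose all degrees are large and take the breadth-first levels
  of a component. Every vertex \<open>y\<close> below the root has a least neighbour \<open>parent y\<close> one level
  nearer to the root. Since there are many edges, some edge survives a bounded number of rounds of
  deleting, at each vertex \<open>x\<close>, the few edges to those neighbours nearer to the root that have the
  smallest parents, and then, at each vertex, the edges that lead away from the root if only few of
  them remain. The rounds leave enough choice to walk from a surviving edge along an induced path
  that alternates between two consecutive levels such that the parents decrease along the level
  nearer to the root and the parent of the first vertex sees no later one (\<open>exists_zigzag\<close>). Minimality of parents then guarantees that the parent of the last
  vertex sees no earlier one. Hence the two ends can be joined through the levels nearer to the root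
  without creating a chord, which gives a long chordless cycle (\<open>chordless_cycle_of_zigzag\<close>).
\<close>

section \<open>Induced copies and chordless cycles\<close>

definition chordless_cycle :: "('a \<Rightarrow> 'a \<Rightarrow> bool) \<Rightarrow> (nat \<Rightarrow> 'a) \<Rightarrow> nat \<Rightarrow> bool" where
  "chordless_cycle adj c m \<longleftrightarrow> inj_on c {..<m} \<and>
     (\<forall>i<m. \<forall>j<m. adj (c i) (c j) \<longleftrightarrow> j = Suc i mod m \<or> i = Suc j mod m)"

text \<open>
  A shortest connection between the ends of the path inside \<open>W\<close> is itself induced, and
  since the inner vertices of the path see nothing of \<open>W\<close> the union has no chords either. The path
  has at least two edges, so its ends are not adjacent and the connection contributes at least two
  edges of its own.
\<close>

lemma chordless_cycle_closing_path:
  fixes adj :: "'a \<Rightarrow> 'a \<Rightarrow> bool" and v :: "nat \<Rightarrow> 'a"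
  assumes sym: "\<And>a b. adj a b \<Longrightarrow> adj b a"
    and irrefl: "\<And>a. \<not> adj a a"
    and inj: "inj_on v {..l}"
    and path: "\<And>i j. \<lbrakk>i \<le> l; j \<le> l\<rbrakk> \<Longrightarrow> adj (v i) (v j) \<longleftrightarrow> j = Suc i \<or> i = Suc j"
    and l: "2 \<le> l"
    and conn: "(v 0, v l) \<in> {(a, b). adj a b \<and> a \<in> insert (v 0) (insert (v l) W)
                                            \<and> b \<in> insert (v 0) (insert (v l) W)}\<^sup>*"
    and disj: "\<And>i. i \<le> l \<Longrightarrow> v i \<notin> W"
    and anti: "\<And>w i. \<lbrakk>w \<in> W; 0 < i; i < l\<rbrakk> \<Longrightarrow> \<not> adj w (v i)"
  shows "\<exists>c m. l + 2 \<le> m \<and> chordless_cycle adj c m"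
proof -
  define R where "R = {(a, b). adj a b \<and> a \<in> insert (v 0) (insert (v l) W)
                                         \<and> b \<in> insert (v 0) (insert (v l) W)}"
  define s where "s = (LEAST n. (v 0, v l) \<in> R ^^ n)"
  have "\<exists>n. (v 0, v l) \<in> R ^^ n"
    using conn unfolding R_def by (simp add: rtrancl_power)
  then have s: "(v 0, v l) \<in> R ^^ s"
    unfolding s_def by (rule LeastI_ex)
  have s_least: "s \<le> n" if "(v 0, v l) \<in> R ^^ n" for n
    unfolding s_def using that by (rule Least_le)
  obtain q where q0: "q 0 = v 0" and qs: "q s = v l"
    and q: "\<And>i. i < s \<Longrightarrow> (q i, q (Suc i)) \<in> R"
    using relpow_fun_conv[of "v 0" "v l" s R] s by auto
  have v0l: "v 0 \<noteq> v l"
    using inj_on_eq_iff[OF inj, of 0 l] l by simp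
  have nadj0l: "\<not> adj (v 0) (v l)"
    using path[of 0 l] l by simp
  have segment: "(q i, q (i + n)) \<in> R ^^ n" if "i + n \<le> s" for i n
    using that by (induction n) (auto intro!: q)
  have pre: "(v 0, q i) \<in> R ^^ i" if "i \<le> s" for i
    using segment[of 0 i] that q0 by simp
  have post: "(q j, v l) \<in> R ^^ (s - j)" if "j \<le> s" for j
    using segment[of j "s - j"] that qs by simp
  have q_range: "q i \<in> insert (v 0) (insert (v l) W)" if "i \<le> s" for i
  proof (cases i)
    case 0
    then show ?thesis using q0 by simp
  next
    case (Suc i')
    then show ?thesis using q[of i'] that by (simp add: R_def)
  qed
  have q_neq: "q i \<noteq> q j" if "i < j" "j \<le> s" for i j
  proof
    assume "q i = q j"
    then have "(v 0, v l) \<in> R ^^ (i + (s - j))"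
      using pre[of i] post[of j] that by (subst relpow_add) auto
    then show False using s_least[of "i + (s - j)"] that by linarith
  qed
  have q_nochord: "\<not> adj (q i) (q j)" if "i < j" "j \<le> s" "j \<noteq> Suc i" for i j
  proof
    assume "adj (q i) (q j)"
    then have "(q i, q j) \<in> R"
      using q_range[of i] q_range[of j] that by (simp add: R_def)
    then have "(v 0, q j) \<in> R ^^ Suc i"
      using pre[of i] that by auto
    then have "(v 0, v l) \<in> R ^^ (Suc i + (s - j))"
      using post[of j] that by (subst relpow_add) blast
    then show False using s_least[of "Suc i + (s - j)"] that by linarith
  qed
  have q_adj: "adj (q i) (q j) \<longleftrightarrow> j = Suc i \<or> i = Suc j" if "i \<le> s" "j \<le> s" for i j
  proof -
    have succ: "adj (q i) (q (Suc i))" if "i < s" for i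
      using q[OF that] by (simp add: R_def)
    have upper: "adj (q i) (q j) \<longleftrightarrow> j = Suc i" if "i < j" "j \<le> s" for i j
      using succ[of i] q_nochord[OF that] that by auto
    consider "i = j" | "i < j" | "j < i" by linarith
    then show ?thesis
    proof cases
      case 3
      have "adj (q i) (q j) \<longleftrightarrow> adj (q j) (q i)" using sym by blast
      then show ?thesis using upper[of j i] 3 that by simp
    qed (use upper[of i j] irrefl that in auto)
  qed
  have s2: "2 \<le> s"
  proof -
    have "s \<noteq> 0" using q0 qs v0l by (metis)
    moreover have "s \<noteq> 1" using q_adj[of 0 1] q0 qs nadj0l by auto
    ultimately show ?thesis by linarith
  qed
  have q_inner: "q j \<in> W" if "0 < j" "j < s" for j
    using q_range[of j] q_neq[of 0 j] q_neq[of j s] q0 qs that by auto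
  \<comment> \<open>Along the path, and then back along the connection, whose ends \<open>q 0\<close> and \<open>q s\<close>
    are already on the path.\<close>
  define c where "c t = (if t \<le> l then v t else q (l + s - t))" for t
  have cross: "c t \<noteq> c t' \<and> (adj (c t) (c t') \<longleftrightarrow> t = 0 \<and> Suc t' = l + s \<or> t' = Suc t)"
    if t: "t \<le> l" "l < t'" "t' < l + s" for t t'
  proof -
    define j where "j = l + s - t'"
    have j: "0 < j" "j < s" using t by (auto simp: j_def)
    have neq: "v t \<noteq> q j" using disj[of t] q_inner[OF j] t by metis
    consider "t = 0" | "t = l" | "0 < t" "t < l" using t by linarith
    then have "adj (v t) (q j) \<longleftrightarrow> t = 0 \<and> Suc t' = l + s \<or> t' = Suc t"
    proof cases
      case 1
      then show ?thesis using q_adj[of 0 j] j q0 l t by (auto simp: j_def)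
    next
      case 2
      then show ?thesis using q_adj[of s j] j qs l t by (auto simp: j_def)
    next
      case 3
      then have "\<not> adj (v t) (q j)" using anti[OF q_inner[OF j]] sym by blast
      then show ?thesis using 3 t by auto
    qed
    then show ?thesis using neq t by (simp add: c_def j_def)
  qed
  have same: "c t \<noteq> c t' \<and> (adj (c t) (c t') \<longleftrightarrow> t' = Suc t)"
    if "t < t'" "t' < l + s" "t' \<le> l \<or> l < t" for t t'
  proof (cases "t' \<le> l")
    case True
    then show ?thesis using that inj_on_eq_iff[OF inj, of t t'] path[of t t'] by (auto simp: c_def)
  next
    case False
    define i j where "i = l + s - t" and "j = l + s - t'"
    have "j < i" "i \<le> s" "i = Suc j \<longleftrightarrow> t' = Suc t" "c t = q i" "c t' = q j"
      using False that by (auto simp: i_def j_def c_def)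
    then show ?thesis using q_neq[of j i] q_adj[of i j] by auto
  qed
  have upper: "c t \<noteq> c t' \<and> (adj (c t) (c t') \<longleftrightarrow> t' = Suc t \<or> t = 0 \<and> Suc t' = l + s)"
    if "t < t'" "t' < l + s" for t t'
  proof (cases "t' \<le> l \<or> l < t")
    case True
    then show ?thesis using same[of t t'] that l s2 by auto
  next
    case False
    then show ?thesis using cross[of t t'] that by auto
  qed
  have succ_mod: "j = Suc i mod (l + s) \<longleftrightarrow> j = Suc i \<or> j = 0 \<and> Suc i = l + s"
    if "i < l + s" "j < l + s" for i j
    using that by (cases "Suc i = l + s") auto
  have "chordless_cycle adj c (l + s)"
    unfolding chordless_cycle_def
  proof (intro conjI allI impI)
    show "inj_on c {..<l + s}"
      by (rule linorder_inj_onI) (use upper in auto)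
    fix i j assume ij: "i < l + s" "j < l + s"
    consider "i = j" | "i < j" | "j < i" by linarith
    then show "adj (c i) (c j) \<longleftrightarrow> j = Suc i mod (l + s) \<or> i = Suc j mod (l + s)"
    proof cases
      case 1
      then show ?thesis using irrefl succ_mod[of i j] ij l by auto
    next
      case 2
      then show ?thesis using upper[of i j] succ_mod[of i j] succ_mod[of j i] ij by auto
    next
      case 3
      have "adj (c i) (c j) \<longleftrightarrow> adj (c j) (c i)" using sym by blast
      then show ?thesis using 3 upper[of j i] succ_mod[of i j] succ_mod[of j i] ij by auto
    qed
  qed
  then show ?thesis using s2 by (intro exI[of _ c] exI[of _ "l + s"]) simp
qed

text \<open>
  Copies are exhibited by an embedding of the small graph, which is the direction opposite to
  the one in which isomorphisms are required.
\<close>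

lemma contains_inducedI:
  assumes inj: "inj_on g (verts H)" and sub: "g ` verts H \<subseteq> verts G"
    and adj: "\<And>p q. \<lbrakk>p \<in> verts H; q \<in> verts H\<rbrakk> \<Longrightarrow> {g p, g q} \<in> edges G \<longleftrightarrow> {p, q} \<in> edges H"
  shows "contains_induced G H"
proof -
  have "bij_betw (inv_into (verts H) g) (g ` verts H) (verts H)"
    using inj by (simp add: bij_betw_inv_into inj_on_imp_bij_betw)
  moreover have "{u, w} \<in> edges G \<longleftrightarrow>
      {inv_into (verts H) g u, inv_into (verts H) g w} \<in> edges H"
    if "u \<in> g ` verts H" "w \<in> g ` verts H" for u w
    using adj[of "inv_into (verts H) g u" "inv_into (verts H) g w"] that
    by (simp add: inv_into_into f_inv_into_f)
  ultimately have "graph_iso (induced_subgraph G (g ` verts H)) H"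
    unfolding graph_iso_def induced_subgraph_def
    by (intro exI[of _ "inv_into (verts H) g"]) simp
  then show ?thesis using sub unfolding contains_induced_def by blast
qed

lemma contains_induced_cycle_graph:
  assumes "chordless_cycle (\<lambda>u v. {u, v} \<in> edges G) c m" "c ` {..<m} \<subseteq> verts G"
  shows "contains_induced G (cycle_graph m)"
proof (rule contains_inducedI[where g = c])
  show "inj_on c (verts (cycle_graph m))" "c ` verts (cycle_graph m) \<subseteq> verts G"
    using assms by (auto simp: chordless_cycle_def cycle_graph_def)
  fix i j assume "i \<in> verts (cycle_graph m)" "j \<in> verts (cycle_graph m)"
  then show "{c i, c j} \<in> edges G \<longleftrightarrow> {i, j} \<in> edges (cycle_graph m)"
    using assms(1) by (auto simp: chordless_cycle_def cycle_graph_def doubleton_eq_iff)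
qed

section \<open>Traces of neighbourhoods in bipartite graphs without the forbidden graph\<close>

lemma bipartite_colouring:
  assumes "bipartite G"
  obtains A where "\<And>u v. {u, v} \<in> edges G \<Longrightarrow> (u \<in> A) \<noteq> (v \<in> A)"
proof -
  obtain A B where AB: "A \<inter> B = {}" "\<And>e. e \<in> edges G \<Longrightarrow> \<exists>a\<in>A. \<exists>b\<in>B. e = {a, b}"
    using assms unfolding bipartite_def by auto
  have "(u \<in> A) \<noteq> (v \<in> A)" if "{u, v} \<in> edges G" for u v
    using AB(1) AB(2)[OF that] by (auto simp: doubleton_eq_iff)
  then show thesis using that by blast
qed

definition neighbours :: "'a ugraph \<Rightarrow> 'a \<Rightarrow> 'a set" where
  "neighbours G v = {u. {u, v} \<in> edges G}"

text \<open>
  The six vertices would induce the square \<open>a, b, a', x\<close> with \<open>a''\<close> pendant at \<open>b\<close> and \<open>z\<close>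
  pendant at \<open>a\<close>. In terms of traces on the neighbourhood of \<open>b\<close>: two different traces that meet
  cover it.
\<close>

lemma A_free_trace:
  assumes G: "simple_graph G" "bipartite G" "free_of G graph_A"
    and b: "a \<in> neighbours G b" "a' \<in> neighbours G b" "a'' \<in> neighbours G b"
    and x: "a \<in> neighbours G x" "a' \<in> neighbours G x" "a'' \<notin> neighbours G x"
    and z: "a \<in> neighbours G z" "a' \<notin> neighbours G z" "a'' \<notin> neighbours G z"
  shows False
proof -
  obtain A where A: "\<And>u v. {u, v} \<in> edges G \<Longrightarrow> (u \<in> A) \<noteq> (v \<in> A)"
    using bipartite_colouring[OF G(2)] by blast
  have V: "u \<in> verts G \<and> v \<in> verts G" if "{u, v} \<in> edges G" for u v
    using that G(1) unfolding simple_graph_def by blast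
  have e: "{a, b} \<in> edges G" "{a', b} \<in> edges G" "{a'', b} \<in> edges G"
    "{a, x} \<in> edges G" "{a', x} \<in> edges G" "{a'', x} \<notin> edges G"
    "{a, z} \<in> edges G" "{a', z} \<notin> edges G" "{a'', z} \<notin> edges G"
    using b x z by (simp_all add: neighbours_def)
  have e': "{b, a} \<in> edges G" "{b, a'} \<in> edges G" "{b, a''} \<in> edges G"
    "{x, a} \<in> edges G" "{x, a'} \<in> edges G" "{x, a''} \<notin> edges G"
    "{z, a} \<in> edges G" "{z, a'} \<notin> edges G" "{z, a''} \<notin> edges G"
    using e by (simp_all add: insert_commute)
  have "a \<in> A \<longleftrightarrow> b \<notin> A" "a' \<in> A \<longleftrightarrow> b \<notin> A" "a'' \<in> A \<longleftrightarrow> b \<notin> A" "x \<in> A \<longleftrightarrow> b \<in> A" "z \<in> A \<longleftrightarrow> b \<in> A"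
    using A e by blast+
  note side = this
  have ne: "\<forall>p\<in>{a, a', a''}. \<forall>q\<in>{a, a', a''}. {p, q} \<notin> edges G"
    "\<forall>p\<in>{b, x, z}. \<forall>q\<in>{b, x, z}. {p, q} \<notin> edges G"
    using A side by blast+
  have dist: "a \<noteq> a'" "a \<noteq> a''" "a' \<noteq> a''" "b \<noteq> x" "b \<noteq> z" "x \<noteq> z"
    using e by auto
  have dist': "\<forall>p\<in>{a, a', a''}. \<forall>q\<in>{b, x, z}. p \<noteq> q \<and> q \<noteq> p"
    using side by auto
  define g where "g t = (case t of L1 \<Rightarrow> a'' | L2 \<Rightarrow> b | L3 \<Rightarrow> a' | R1 \<Rightarrow> z | R2 \<Rightarrow> a | R3 \<Rightarrow> x)" for t
  have "contains_induced G graph_A"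
  proof (rule contains_inducedI[where g = g])
    show "inj_on g (verts graph_A)"
    proof (rule inj_onI)
      fix p q assume "g p = g q"
      then show "p = q"
        by (cases p; cases q) (simp_all add: g_def dist dist[symmetric] dist'[simplified])
    qed
    show "g ` verts graph_A \<subseteq> verts G"
      using e V by (auto simp: graph_A_def g_def)
    fix p q
    show "{g p, g q} \<in> edges G \<longleftrightarrow> {p, q} \<in> edges graph_A"
      by (cases p; cases q) (simp_all add: g_def graph_A_def doubleton_eq_iff e e' ne[simplified])
  qed
  then show False using G(3) by (simp add: free_of_def)
qed

text \<open>
  Suppose that \<open>N(b)\<close> has two elements \<open>c, c'\<close> outside \<open>N(x)\<close>, besides the two common elements
  \<open>a, a'\<close>. Some \<open>z\<close> separates \<open>a\<close> from \<open>a'\<close>, and some \<open>y\<close> separates \<open>c\<close> from \<open>c'\<close>. The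
  trace of \<open>z\<close> meets the trace of \<open>x\<close> and differs from it, so it contains \<open>c\<close> and \<open>c'\<close>. It
  therefore meets the trace of \<open>y\<close>, and both cover \<open>N(b)\<close>, so that \<open>y\<close> contains the one of
  \<open>a, a'\<close> that \<open>z\<close> misses. Now the traces of \<open>x\<close> and \<open>y\<close> meet and differ, but both miss one
  of \<open>c, c'\<close>.
\<close>

lemma A_free_twin_free_close:
  assumes G: "simple_graph G" "bipartite G" "free_of G graph_A"
    and twinfree: "\<And>u v. \<lbrakk>u \<in> verts G; v \<in> verts G; u \<noteq> v\<rbrakk> \<Longrightarrow> neighbours G u \<noteq> neighbours G v"
    and a: "a \<noteq> a'" "a \<in> neighbours G b \<inter> neighbours G x" "a' \<in> neighbours G b \<inter> neighbours G x"
    and c: "c \<in> neighbours G b - neighbours G x" "c' \<in> neighbours G b - neighbours G x"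
  shows "c = c'"
proof (rule ccontr)
  assume "c \<noteq> c'"
  have V: "u \<in> verts G" if "u \<in> neighbours G v" for u v
    using that G(1) unfolding simple_graph_def neighbours_def by blast
  have comm: "u \<in> neighbours G v \<longleftrightarrow> v \<in> neighbours G u" for u v
    by (simp add: neighbours_def insert_commute)
  note tr = A_free_trace[OF G]
  have separate: "\<exists>y p q. {p, q} = {s, t} \<and> p \<in> neighbours G y \<and> q \<notin> neighbours G y"
    if "s \<in> neighbours G b" "t \<in> neighbours G b" "s \<noteq> t" for s t
    using twinfree[OF V[OF that(1)] V[OF that(2)] that(3)] comm by blast
  obtain z p q where z: "{p, q} = {a, a'}" "p \<in> neighbours G z" "q \<notin> neighbours G z"
    using separate[of a a'] a by auto
  obtain y r s where y: "{r, s} = {c, c'}" "r \<in> neighbours G y" "s \<notin> neighbours G y"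
    using separate[of c c'] c \<open>c \<noteq> c'\<close> by auto
  have pq: "p \<in> neighbours G b" "q \<in> neighbours G b" "p \<in> neighbours G x" "q \<in> neighbours G x"
    using z(1) a by (auto simp: doubleton_eq_iff)
  have rs: "r \<in> neighbours G b" "s \<in> neighbours G b" "r \<notin> neighbours G x" "s \<notin> neighbours G x"
    using y(1) c by (auto simp: doubleton_eq_iff)
  have zr: "r \<in> neighbours G z" and zs: "s \<in> neighbours G z"
    using tr[of p b q _ x z] pq rs z by blast+
  have yq: "q \<in> neighbours G y"
    using tr[of r b s q z y] pq rs zr zs z y by blast
  show False
    using tr[of q b r s y x] pq rs yq y by blast
qed

section \<open>Long chordless cycles in bipartite graphs without squares\<close>

text \<open>
  Below the element with the largest key among those counted lie all the others.
\<close>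

lemma card_few_lower_le:
  fixes key :: "'a \<Rightarrow> 'b::linorder"
  assumes fin: "finite S" and inj: "inj_on key S"
  shows "card {y \<in> S. card {y' \<in> S. key y' < key y} < D} \<le> D"
proof (rule ccontr)
  define T where "T = {y \<in> S. card {y' \<in> S. key y' < key y} < D}"
  assume "\<not> card {y \<in> S. card {y' \<in> S. key y' < key y} < D} \<le> D"
  then have T: "D < card T" by (simp add: T_def)
  have finT: "finite T" using fin by (simp add: T_def)
  have "T \<noteq> {}" using T by auto
  then have "Max (key ` T) \<in> key ` T" using finT by (intro Max_in) auto
  then obtain y where y: "y \<in> T" "key y = Max (key ` T)" by (metis imageE)
  have "T - {y} \<subseteq> {y' \<in> S. key y' < key y}"
  proof
    fix y' assume y': "y' \<in> T - {y}"
    then have "key y' \<le> key y" using y finT by simp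
    moreover have "key y' \<noteq> key y" using inj_onD[OF inj] y y' by (auto simp: T_def)
    ultimately show "y' \<in> {y' \<in> S. key y' < key y}" using y' by (auto simp: T_def)
  qed
  then have "card (T - {y}) \<le> card {y' \<in> S. key y' < key y}"
    using fin by (intro card_mono) auto
  moreover have "card {y' \<in> S. key y' < key y} < D" using y(1) by (simp add: T_def)
  ultimately show False using T y(1) finT by simp
qed

locale square_free_bipartite =
  fixes V :: "'a::wellorder set" and adj :: "'a \<Rightarrow> 'a \<Rightarrow> bool" and side :: "'a set"
  assumes finite_V: "finite V"
    and adj_V: "adj u v \<Longrightarrow> u \<in> V"
    and adj_sym: "adj u v \<Longrightarrow> adj v u"
    and adj_side: "adj u v \<Longrightarrow> (u \<in> side) \<noteq> (v \<in> side)"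
    and square_free: "\<lbrakk>u \<noteq> v; adj u a; adj v a; adj u b; adj v b\<rbrakk> \<Longrightarrow> a = b"
begin

lemma adj_irrefl: "\<not> adj u u"
  using adj_side by blast

text \<open>
  Without squares, each vertex of \<open>F\<close> sees at most one neighbour of \<open>z\<close>. This is the tool
  for extending induced paths greedily.
\<close>

lemma exists_avoiding:
  assumes F: "finite F" "card F < card C" "z \<notin> F" and C: "\<And>a. a \<in> C \<Longrightarrow> adj z a"
  obtains a where "a \<in> C" "\<And>u. u \<in> F \<Longrightarrow> \<not> adj u a"
proof (rule ccontr)
  assume "\<not> thesis"
  then have "\<forall>a\<in>C. \<exists>u\<in>F. adj u a" using that by blast
  then obtain g where g: "\<And>a. a \<in> C \<Longrightarrow> g a \<in> F \<and> adj (g a) a" by metis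
  have "inj_on g C"
  proof (rule inj_onI)
    fix a b assume ab: "a \<in> C" "b \<in> C" "g a = g b"
    then show "a = b" using square_free[of z "g a" a b] g[of a] g[of b] C F(3) by auto
  qed
  then have "card C \<le> card F" using g F(1) by (intro card_inj_on_le[of g]) auto
  then show False using F(2) by simp
qed

definition component :: "'a \<Rightarrow> 'a set" where
  "component r = {v. (r, v) \<in> {(u, v). adj u v}\<^sup>*}"

definition level :: "'a \<Rightarrow> 'a \<Rightarrow> nat" where
  "level r v = (LEAST n. (r, v) \<in> {(u, v). adj u v} ^^ n)"

text \<open>
  Choosing the least candidate in a fixed order of all vertices, instead of an arbitrary one, is
  what makes the closing of paths work: a vertex that precedes \<open>parent r v\<close> in the order, and lies
  on the same level, is not adjacent to \<open>v\<close>.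
\<close>

definition parent :: "'a \<Rightarrow> 'a \<Rightarrow> 'a" where
  "parent r v = (LEAST w. adj w v \<and> level r v = Suc (level r w))"

context
  fixes r :: 'a
  assumes r: "r \<in> V"
begin

abbreviation (input) "C \<equiv> component r"
abbreviation (input) "lev \<equiv> level r"
abbreviation (input) "par \<equiv> parent r"

lemma component_subset: "C \<subseteq> V"
proof
  fix v assume "v \<in> C"
  then have "(r, v) \<in> {(u, v). adj u v}\<^sup>*" by (simp add: component_def)
  then show "v \<in> V" by (induction rule: rtrancl_induct) (use r adj_V adj_sym in blast)+
qed

lemma finite_component: "finite C"
  using component_subset finite_V finite_subset by blast

lemma root_in_component: "r \<in> C"
  by (simp add: component_def)

lemma adj_component: "\<lbrakk>u \<in> C; adj u v\<rbrakk> \<Longrightarrow> v \<in> C"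
  unfolding component_def by (auto intro: rtrancl_into_rtrancl)

lemma level_walk: "v \<in> C \<Longrightarrow> (r, v) \<in> {(u, v). adj u v} ^^ lev v"
  unfolding level_def component_def by (auto simp: rtrancl_power intro: LeastI)

lemma level_le: "(r, v) \<in> {(u, v). adj u v} ^^ n \<Longrightarrow> lev v \<le> n"
  unfolding level_def by (rule Least_le)

lemma level_0: "v \<in> C \<Longrightarrow> lev v = 0 \<longleftrightarrow> v = r"
  using level_walk[of v] level_le[of v 0] by auto

lemma walk_side: "(r, v) \<in> {(u, v). adj u v} ^^ n \<Longrightarrow> (v \<in> side \<longleftrightarrow> (r \<in> side \<longleftrightarrow> even n))"
proof (induction n arbitrary: v)
  case (Suc n)
  then obtain u where "(r, u) \<in> {(u, v). adj u v} ^^ n" "adj u v" by auto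
  then show ?case using Suc.IH[of u] adj_side[of u v] by auto
qed simp

lemma level_adj:
  assumes "u \<in> C" "adj u v"
  shows "lev u = Suc (lev v) \<or> lev v = Suc (lev u)"
proof -
  have le: "lev v \<le> Suc (lev u)" if "u \<in> C" "adj u v" for u v
    using level_walk[OF that(1)] that(2) by (intro level_le) auto
  have v: "v \<in> C" using assms adj_component by blast
  have "lev u \<noteq> lev v"
    using walk_side[OF level_walk[OF assms(1)]] walk_side[OF level_walk[OF v]] adj_side[OF assms(2)]
    by auto
  then show ?thesis using le[OF assms] le[OF v adj_sym[OF assms(2)]] by linarith
qed

lemma parent:
  assumes "v \<in> C" "lev v \<noteq> 0"
  shows "adj (par v) v" "lev v = Suc (lev (par v))" "par v \<in> C"
proof -
  obtain n where n: "lev v = Suc n" using assms(2) not0_implies_Suc by blast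
  then obtain u where u: "(r, u) \<in> {(u, v). adj u v} ^^ n" "adj u v"
    using level_walk[OF assms(1)] by auto
  then have "u \<in> C" by (auto simp: component_def rtrancl_power)
  then have "adj u v \<and> lev v = Suc (lev u)"
    using u level_le[OF u(1)] level_adj[of u v] n by auto
  then have "adj (par v) v \<and> lev v = Suc (lev (par v))"
    unfolding parent_def by (rule LeastI)
  then show "adj (par v) v" "lev v = Suc (lev (par v))" "par v \<in> C"
    using adj_component[OF assms(1)] adj_sym by auto
qed

lemma parent_le: "\<lbrakk>adj w v; lev v = Suc (lev w)\<rbrakk> \<Longrightarrow> par v \<le> w"
  unfolding parent_def by (rule Least_le) simp

text \<open>
  Two neighbours of \<open>x\<close> one level nearer to the root that have the same parent would form a square
  with \<open>x\<close> and that parent. If they have no parent, they are the root.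
\<close>

lemma inj_on_parent:
  assumes x: "x \<in> C"
  shows "inj_on par {y. adj x y \<and> lev x = Suc (lev y)}"
proof (rule inj_onI)
  fix y y' assume y: "y \<in> {y. adj x y \<and> lev x = Suc (lev y)}"
    and y': "y' \<in> {y. adj x y \<and> lev x = Suc (lev y)}" and eq: "par y = par y'"
  have yC: "y \<in> C" "y' \<in> C" using x y y' adj_component by blast+
  show "y = y'"
  proof (cases "lev y = 0")
    case True
    then show ?thesis using level_0[OF yC(1)] level_0[OF yC(2)] y y' by auto
  next
    case False
    then have "lev y' \<noteq> 0" using y y' by auto
    note p = parent[OF yC(1) False] and p' = parent[OF yC(2) this]
    have "lev x = Suc (Suc (lev (par y)))" using y p(2) by simp
    then have "par y \<noteq> x" by auto
    then show ?thesis
      using square_free[of "par y" x y y'] p(1) p'(1) y y' eq by simp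
  qed
qed

text \<open>
  An arc leads from a vertex \<open>x\<close> to a neighbour \<open>y\<close> one level nearer to the root. The arcs that
  survive one more round of both deletions allow a path to be prolonged by two edges: an arc
  into \<open>y\<close> guarantees \<open>D\<close> possible continuations \<open>x\<close> of a path that ends in \<open>y\<close>, and from each
  such \<open>x\<close> there are \<open>D\<close> possible next vertices with a smaller parent than \<open>y\<close>.
\<close>

definition thin_lower :: "nat \<Rightarrow> ('a \<times> 'a) set \<Rightarrow> ('a \<times> 'a) set" where
  "thin_lower D E = {(x, y) \<in> E. D \<le> card {y'. (x, y') \<in> E \<and> par y' < par y}}"

definition thin_degree :: "nat \<Rightarrow> ('a \<times> 'a) set \<Rightarrow> ('a \<times> 'a) set" where
  "thin_degree D E = {(x, y) \<in> E. D \<le> card {x'. (x', y) \<in> E}}"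

definition down_arcs :: "('a \<times> 'a) set" where
  "down_arcs = {(x, y). x \<in> C \<and> adj x y \<and> lev x = Suc (lev y)}"

fun arcs :: "nat \<Rightarrow> nat \<Rightarrow> ('a \<times> 'a) set" where
  "arcs D 0 = down_arcs"
| "arcs D (Suc t) = thin_degree D (thin_lower D (arcs D t))"

lemma arcs_subset: "arcs D t \<subseteq> down_arcs"
  by (induction t) (auto simp: thin_degree_def thin_lower_def)

lemma down_arcs_subset: "down_arcs \<subseteq> C \<times> C"
  using adj_component by (auto simp: down_arcs_def)

lemma finite_down_arcs: "finite down_arcs"
  using down_arcs_subset finite_component finite_subset by blast

text \<open>
  Parents are distinct among the heads of the arcs at a vertex, so each vertex loses at most \<open>D\<close> arcs.
\<close>

lemma card_thin_lower:
  assumes E: "E \<subseteq> down_arcs"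
  shows "card E \<le> card (thin_lower D E) + D * card C"
proof -
  define B where "B x = {y. (x, y) \<in> E \<and> card {y'. (x, y') \<in> E \<and> par y' < par y} < D}" for x
  have finE: "finite E" using E finite_down_arcs finite_subset by blast
  have B_le: "card (B x) \<le> D" if "x \<in> C" for x
  proof -
    have "{y. (x, y) \<in> E} \<subseteq> {y. adj x y \<and> lev x = Suc (lev y)}"
      using E by (auto simp: down_arcs_def)
    then have "inj_on par {y. (x, y) \<in> E}"
      using inj_on_parent[OF that] inj_on_subset by blast
    moreover have "finite {y. (x, y) \<in> E}"
      by (rule finite_subset[OF _ finite_imageI[OF finE, of snd]]) force
    ultimately show ?thesis
      using card_few_lower_le[of "{y. (x, y) \<in> E}" par D] by (simp add: B_def)
  qed
  have finB: "finite (B x)" for x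
    by (rule finite_subset[OF _ finite_imageI[OF finE, of snd]]) (force simp: B_def)
  have "E \<subseteq> thin_lower D E \<union> Sigma C B"
    using E down_arcs_subset by (force simp: thin_lower_def B_def)
  then have "card E \<le> card (thin_lower D E \<union> Sigma C B)"
    using finE finB finite_component by (intro card_mono) (auto simp: thin_lower_def intro: finite_subset[OF _ finE])
  also have "\<dots> \<le> card (thin_lower D E) + card (Sigma C B)" by (rule card_Un_le)
  also have "card (Sigma C B) = (\<Sum>x\<in>C. card (B x))"
    using finB finite_component by (simp add: card_SigmaI)
  also have "\<dots> \<le> (\<Sum>x\<in>C. D)" using B_le by (intro sum_mono)
  finally show ?thesis by (simp add: mult.commute)
qed

lemma card_thin_degree:
  assumes E: "E \<subseteq> down_arcs"
  shows "card E \<le> card (thin_degree D E) + D * card C"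
proof -
  define B where "B y = {x. (x, y) \<in> E \<and> card {x'. (x', y) \<in> E} < D}" for y
  have finE: "finite E" using E finite_down_arcs finite_subset by blast
  have B_le: "card (B y) \<le> D" for y
    by (cases "card {x'. (x', y) \<in> E} < D") (auto simp: B_def)
  have finB: "finite (B y)" for y
    by (rule finite_subset[OF _ finite_imageI[OF finE, of fst]]) (force simp: B_def)
  have fin: "finite (prod.swap ` Sigma C B)" using finB finite_component by auto
  have "E \<subseteq> thin_degree D E \<union> prod.swap ` Sigma C B"
  proof (rule subrelI)
    fix x y assume xy: "(x, y) \<in> E"
    then have "y \<in> C" using E down_arcs_subset by auto
    then show "(x, y) \<in> thin_degree D E \<union> prod.swap ` Sigma C B"
      using xy by (cases "D \<le> card {x'. (x', y) \<in> E}") (auto simp: thin_degree_def B_def image_iff)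
  qed
  then have "card E \<le> card (thin_degree D E \<union> prod.swap ` Sigma C B)"
    using fin by (intro card_mono) (auto simp: thin_degree_def intro: finite_subset[OF _ finE])
  also have "\<dots> \<le> card (thin_degree D E) + card (prod.swap ` Sigma C B)" by (rule card_Un_le)
  also have "card (prod.swap ` Sigma C B) \<le> card (Sigma C B)"
    using finB finite_component by (intro card_image_le) auto
  also have "card (Sigma C B) = (\<Sum>x\<in>C. card (B x))"
    using finB finite_component by (simp add: card_SigmaI)
  also have "\<dots> \<le> (\<Sum>x\<in>C. D)" using B_le by (intro sum_mono)
  finally show ?thesis by (simp add: mult.commute)
qed

lemma card_down_arcs_le: "card down_arcs \<le> card (arcs D t) + 2 * t * D * card C"
proof (induction t)
  case (Suc t)
  have sub: "thin_lower D (arcs D t) \<subseteq> down_arcs"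
    using arcs_subset by (auto simp: thin_lower_def)
  show ?case
    using Suc card_thin_lower[OF arcs_subset, of D t D] card_thin_degree[OF sub, of D]
    by (simp add: algebra_simps)
qed simp

text \<open>
  In a bipartite graph no edge joins two vertices of the same level, so each edge of the component
  is an arc in exactly one direction.
\<close>

lemma sum_degree_eq: "(\<Sum>v\<in>C. card {u. adj u v}) = 2 * card down_arcs"
proof -
  have fin: "finite {u. adj u v}" for v
    using finite_V adj_V by (auto intro: finite_subset)
  have "(\<Sum>v\<in>C. card {u. adj u v}) = card (Sigma C (\<lambda>v. {u. adj u v}))"
    using fin finite_component by (simp add: card_SigmaI)
  also have "Sigma C (\<lambda>v. {u. adj u v}) = down_arcs \<union> prod.swap ` down_arcs"
  proof -
    have "(v, u) \<in> down_arcs \<union> prod.swap ` down_arcs" if "v \<in> C" "adj u v" for u v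
      using level_adj[OF that(1) adj_sym[OF that(2)]] that adj_component adj_sym
      by (force simp: down_arcs_def image_iff)
    moreover have "v \<in> C \<and> adj u v" if "(v, u) \<in> down_arcs \<union> prod.swap ` down_arcs" for u v
      using that adj_component adj_sym by (force simp: down_arcs_def image_iff)
    ultimately have "(v, u) \<in> Sigma C (\<lambda>v. {u. adj u v})
        \<longleftrightarrow> (v, u) \<in> down_arcs \<union> prod.swap ` down_arcs" for u v
      unfolding mem_Sigma_iff mem_Collect_eq by blast
    then show ?thesis by (intro subset_antisym subrelI) blast+
  qed
  also have "card \<dots> = card down_arcs + card (prod.swap ` down_arcs)"
    using finite_down_arcs by (intro card_Un_disjoint) (auto simp: down_arcs_def)
  also have "card (prod.swap ` down_arcs) = card down_arcs"
    by (intro card_image) (auto intro: inj_onI)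
  finally show ?thesis by simp
qed

text \<open>
  Vertices with even index lie on the level of \<open>v 0\<close>, those with odd index one level further from
  the root. The last two conditions are used to separate the parents of the two ends from the
  inner vertices.
\<close>

definition zigzag :: "nat \<Rightarrow> (nat \<Rightarrow> 'a) \<Rightarrow> bool" where
  "zigzag l v \<longleftrightarrow>
     (\<forall>i\<le>l. v i \<in> C \<and> lev (v i) = lev (v 0) + i mod 2) \<and>
     (\<forall>i\<le>l. \<forall>j\<le>l. adj (v i) (v j) \<longleftrightarrow> j = Suc i \<or> i = Suc j) \<and> inj_on v {..l} \<and>
     (\<forall>i. 0 < i \<and> i \<le> l \<and> even i \<longrightarrow> \<not> adj (par (v 0)) (v i)) \<and>
     (\<forall>i<l. even i \<longrightarrow> par (v l) < par (v i))"

lemma zigzagD: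
  assumes "zigzag l v"
  shows "i \<le> l \<Longrightarrow> v i \<in> C"
    and "i \<le> l \<Longrightarrow> lev (v i) = lev (v 0) + i mod 2"
    and "\<lbrakk>i \<le> l; j \<le> l\<rbrakk> \<Longrightarrow> adj (v i) (v j) \<longleftrightarrow> j = Suc i \<or> i = Suc j"
    and "\<lbrakk>0 < i; i \<le> l; even i\<rbrakk> \<Longrightarrow> \<not> adj (par (v 0)) (v i)"
    and "\<lbrakk>i < l; even i\<rbrakk> \<Longrightarrow> par (v l) < par (v i)"
    and "inj_on v {..l}"
  using assms unfolding zigzag_def by blast+

text \<open>
  Each of the two new vertices must avoid the neighbourhoods of at most \<open>l + 1\<close> vertices, and by
  \<open>exists_avoiding\<close> the \<open>D\<close> candidates that are left by the thinning suffice for that.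
\<close>

lemma zigzag_extend:
  assumes z: "zigzag l v" and l: "even l" "l + 2 \<le> D" and arc: "(x0, v l) \<in> arcs D (Suc t)"
  obtains v' x where "zigzag (l + 2) v'" "(x, v' (l + 2)) \<in> arcs D t"
proof -
  note vC = zigzagD(1)[OF z] and lev = zigzagD(2)[OF z] and path = zigzagD(3)[OF z]
    and avoid = zigzagD(4)[OF z] and decr = zigzagD(5)[OF z] and inj = zigzagD(6)[OF z]
  have levl: "lev (v l) = lev (v 0)" using lev[of l] l by simp
  define X where "X = {x. (x, v l) \<in> thin_lower D (arcs D t)}"
  have "D \<le> card X"
    using arc by (simp add: thin_degree_def X_def)
  have arc_D: "x \<in> C \<and> adj x y \<and> lev x = Suc (lev y)" if "(x, y) \<in> arcs D t" for x y
    using that arcs_subset by (force simp: down_arcs_def)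
  have X: "adj x (v l)" "lev x = Suc (lev (v 0))" "x \<in> C" if "x \<in> X" for x
    using that levl arc_D[of x "v l"] by (auto simp: X_def thin_lower_def)
  have "card (v ` {..<l}) \<le> l" using card_image_le[of "{..<l}" v] by simp
  then have "card (v ` {..<l}) < card X" using \<open>D \<le> card X\<close> l by linarith
  moreover have "v l \<notin> v ` {..<l}"
    using inj_on_image_mem_iff[OF inj, of l "{..<l}"] by (simp add: subset_iff)
  ultimately obtain x where x: "x \<in> X" "\<And>i. i < l \<Longrightarrow> \<not> adj (v i) x"
    using exists_avoiding[of "v ` {..<l}" X "v l"] X adj_sym by (metis finite_imageI finite_lessThan imageI lessThan_iff)
  note xX = X[OF x(1)]
  have xl: "adj (v l) x" using xX adj_sym by blast
  define Y where "Y = {y. (x, y) \<in> arcs D t \<and> par y < par (v l)}"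
  have cardY: "D \<le> card Y" using x(1) by (simp add: X_def thin_lower_def Y_def)
  have Y: "adj x y" "lev y = lev (v 0)" "y \<in> C" if "y \<in> Y" for y
    using that arc_D[of x y] xX adj_component[of x y] by (auto simp: Y_def)
  have x_new: "x \<noteq> v i" if "i \<le> l" for i
  proof
    assume eq: "x = v i"
    then have "i = Suc l \<or> l = Suc i" using path[of i l] xX that by simp
    then have i: "l = Suc i" using that by simp
    then have "0 < i" using l by (cases i) auto
    then have "adj (v (i - 1)) x" using path[of "i - 1" i] eq i by simp
    moreover have "i - 1 < l" using i by simp
    ultimately show False using x(2) by blast
  qed
  have "card Y > 0" using cardY l by simp
  then obtain y0 where y0: "y0 \<in> Y" using card_gt_0_iff by (metis ex_in_conv)
  \<comment> \<open>The root is alone on its level, but this level contains two vertices with different parents.\<close>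
  have lev0: "lev (v 0) \<noteq> 0"
  proof
    assume "lev (v 0) = 0"
    then have "y0 = r" "v l = r" using level_0 Y[OF y0] levl vC[of l] by auto
    then show False using y0 by (simp add: Y_def)
  qed
  define F where "F = insert (par (v 0)) (v ` {..<l})"
  have "card F \<le> Suc (card (v ` {..<l}))" unfolding F_def by (rule card_insert_le_m1) auto
  then have "card F < card Y" using \<open>card (v ` {..<l}) \<le> l\<close> cardY l by linarith
  moreover have "x \<notin> v ` {..<l}"
    using x_new by (metis imageE lessThan_iff less_imp_le)
  then have "x \<notin> F"
    using parent(2)[OF vC[of 0] lev0] xX by (auto simp: F_def)
  moreover have "finite F" by (simp add: F_def)
  ultimately obtain y where y: "y \<in> Y" "\<And>u. u \<in> F \<Longrightarrow> \<not> adj u y"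
    using exists_avoiding[of F Y x] Y(1) by blast
  note yY = Y[OF y(1)]
  have y_par: "par y < par (v l)" "(x, y) \<in> arcs D t" using y(1) by (auto simp: Y_def)
  have same: "\<not> adj u w" if "u \<in> C" "lev u = lev w" for u w
    using level_adj[of u w] that by auto
  have y_nadj: "\<not> adj (v i) y" if "i \<le> l" for i
  proof (cases "i = l")
    case True
    then show ?thesis using same[of "v l" y] vC[of l] levl yY by simp
  next
    case False
    then show ?thesis using that y(2)[of "v i"] by (simp add: F_def)
  qed
  have y_new: "y \<noteq> v i" if "i \<le> l" for i
    using x(2)[of i] y_par yY that adj_sym by (cases "i = l") auto
  have xy: "adj x y" "adj y x" "x \<noteq> y" using yY adj_sym adj_irrefl by auto
  define v' where "v' = v(l + 1 := x, l + 2 := y)"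
  have v'_old: "v' i = v i" if "i \<le> l" for i using that by (simp add: v'_def)
  have v'1: "v' (Suc l) = x" and v'2: "v' (Suc (Suc l)) = y" by (simp_all add: v'_def)
  have cases_l: "i \<le> l \<or> i = Suc l \<or> i = Suc (Suc l)" if "i \<le> l + 2" for i using that by linarith
  have new1: "adj (v i) x \<longleftrightarrow> i = l" "adj x (v i) \<longleftrightarrow> i = l" if "i \<le> l" for i
    using that x(2)[of i] xl adj_sym by (cases "i = l"; auto)+
  have new2: "\<not> adj (v i) y" "\<not> adj y (v i)" if "i \<le> l" for i
    using that y_nadj adj_sym by blast+
  have "zigzag (l + 2) v'"
    unfolding zigzag_def
  proof (intro conjI allI impI)
    fix i assume i: "i \<le> l + 2"
    show "v' i \<in> C"
      using cases_l[OF i] vC xX yY by (auto simp: v'_old v'1 v'2)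
    show "lev (v' i) = lev (v' 0) + i mod 2"
      using cases_l[OF i] lev[of i] xX(2) yY(2) l by (auto simp: v'_old v'1 v'2 mod_Suc even_iff_mod_2_eq_zero)
  next
    fix i j assume i: "i \<le> l + 2" and j: "j \<le> l + 2"
    show "adj (v' i) (v' j) \<longleftrightarrow> j = Suc i \<or> i = Suc j"
      using cases_l[OF i] cases_l[OF j]
      by (elim disjE) (auto simp: v'_old v'1 v'2 path new1 new2 xy adj_irrefl)
  next
    show "inj_on v' {..l + 2}"
    proof (rule linorder_inj_onI)
      fix i j assume ij: "i < j" "j \<in> {..l + 2}"
      then show "v' i \<noteq> v' j"
        using cases_l[of i] cases_l[of j] x_new[of i] y_new[of i] xy(3) inj_on_eq_iff[OF inj, of i j]
        by (auto simp: v'_old v'1 v'2)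
    qed auto
  next
    fix i assume i: "0 < i \<and> i \<le> l + 2 \<and> even i"
    then show "\<not> adj (par (v' 0)) (v' i)"
      using cases_l[of i] avoid[of i] y(2)[of "par (v 0)"] l by (auto simp: v'_old v'2 F_def)
  next
    fix i assume i: "i < l + 2" "even i"
    then have "i \<le> l" using l by (cases "i = Suc l") auto
    then have "par (v l) \<le> par (v i)" using decr[of i] i by (cases "i = l") auto
    then show "par (v' (l + 2)) < par (v' i)"
      using y_par \<open>i \<le> l\<close> by (simp add: v'_old v'2)
  qed
  then show thesis using that[of v' x] y_par(2) v'2 by simp
qed

lemma exists_zigzag:
  assumes "arcs D t \<noteq> {}" "s \<le> t" "2 * t \<le> D"
  shows "\<exists>v x. zigzag (2 * s) v \<and> (x, v (2 * s)) \<in> arcs D (t - s)"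
  using assms(2)
proof (induction s)
  case 0
  obtain x y where xy: "(x, y) \<in> arcs D t" using assms(1) by auto
  then have "x \<in> C" "adj x y" using arcs_subset by (force simp: down_arcs_def)+
  then have "y \<in> C" using adj_component by blast
  then have "zigzag 0 (\<lambda>_. y)" by (auto simp: zigzag_def adj_irrefl)
  then show ?case using xy by auto
next
  case (Suc s)
  then obtain v x where v: "zigzag (2 * s) v" "(x, v (2 * s)) \<in> arcs D (t - s)" by auto
  have ts: "t - s = Suc (t - Suc s)" using Suc.prems by simp
  obtain v' x' where "zigzag (2 * s + 2) v'" "(x', v' (2 * s + 2)) \<in> arcs D (t - Suc s)"
    using zigzag_extend[OF v(1) _ _ v(2)[unfolded ts]] Suc.prems assms(3) by auto
  then show ?case by auto
qed

text \<open>
  The path is closed through the parents of its two ends and the vertices at least two levels nearer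
  to the root, which cannot see it. An inner vertex on the level of the ends is not adjacent to the
  parent of the first vertex by construction, nor to the parent of the last vertex, because that
  parent is smaller than the least one it has itself.
\<close>

lemma chordless_cycle_of_zigzag:
  assumes z: "zigzag l v" and l: "even l" "0 < l"
  shows "\<exists>c m. l + 2 \<le> m \<and> chordless_cycle adj c m"
proof -
  define h where "h = lev (v 0)"
  note vC = zigzagD(1)[OF z] and lev = zigzagD(2)[OF z, folded h_def] and path = zigzagD(3)[OF z]
    and avoid = zigzagD(4)[OF z] and decr = zigzagD(5)[OF z] and inj = zigzagD(6)[OF z]
  have levl: "lev (v l) = h" using lev[of l] l by simp
  have h0: "h \<noteq> 0"
  proof
    assume "h = 0"
    then have "v 0 = r" "v l = r" using level_0 lev[of 0] levl vC by auto
    then show False using inj_on_eq_iff[OF inj, of 0 l] l by auto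
  qed
  define W where "W = {par (v 0), par (v l)} \<union> {w \<in> C. lev w + 2 \<le> h}"
  define U where "U = insert (v 0) (insert (v l) W)"
  define R where "R = {(a, b). adj a b \<and> a \<in> U \<and> b \<in> U}"
  have par0: "adj (par (v 0)) (v 0)" "h = Suc (lev (par (v 0)))" "par (v 0) \<in> C"
    using parent[OF vC[of 0]] lev[of 0] h0 by auto
  have parl: "adj (par (v l)) (v l)" "h = Suc (lev (par (v l)))" "par (v l) \<in> C"
    using parent[OF vC[of l]] levl h0 by auto
  have symR: "(b, a) \<in> R\<^sup>*" if "(a, b) \<in> R\<^sup>*" for a b
  proof -
    have "sym R" using adj_sym by (auto simp: R_def sym_def)
    then show ?thesis using that sym_rtrancl symD by metis
  qed
  have up: "(u, r) \<in> R\<^sup>*" if "u \<in> U" "u \<in> C" "lev u \<le> h" for u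
    using that
  proof (induction "lev u" arbitrary: u rule: less_induct)
    case less
    show ?case
    proof (cases "lev u = 0")
      case True
      then show ?thesis using level_0 less.prems by auto
    next
      case False
      note p = parent[OF less.prems(2) False]
      have "par u \<in> U"
      proof (cases "lev u = h")
        case True
        then have "u = v 0 \<or> u = v l"
          using less.prems(1) par0 parl by (auto simp: U_def W_def)
        then show ?thesis by (auto simp: U_def W_def)
      next
        case False
        then show ?thesis using p less.prems by (auto simp: U_def W_def)
      qed
      then have "(u, par u) \<in> R" "(par u, r) \<in> R\<^sup>*"
        using less.hyps[of "par u"] less.prems p adj_sym by (auto simp: R_def)
      then show ?thesis by (rule converse_rtrancl_into_rtrancl)
    qed
  qed
  have conn: "(v 0, v l) \<in> R\<^sup>*"
    using up[of "v 0"] up[of "v l"] symR vC lev[of 0] levl by (force simp: U_def intro: rtrancl_trans)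
  have W_lev: "w \<in> C \<and> lev w < h" if "w \<in> W" for w
    using that par0 parl by (auto simp: W_def)
  have anti: "\<not> adj w (v i)" if w: "w \<in> W" and i: "0 < i" "i < l" for w i
  proof
    assume a: "adj w (v i)"
    then have "lev w = Suc (lev (v i)) \<or> lev (v i) = Suc (lev w)"
      using level_adj W_lev[OF w] by blast
    then have eq: "lev (v i) = h" "h = Suc (lev w)" using W_lev[OF w] lev[of i] i by auto
    then have ev: "even i" using lev[of i] i by (auto simp: even_iff_mod_2_eq_zero)
    have "w = par (v 0) \<or> w = par (v l)" using w eq by (auto simp: W_def)
    then show False
    proof
      assume "w = par (v 0)"
      then show False using a avoid[of i] i ev by simp
    next
      assume "w = par (v l)"
      then show False
        using parent_le[of w "v i"] a eq decr[of i] i ev by auto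
    qed
  qed
  show ?thesis
  proof (rule chordless_cycle_closing_path[OF adj_sym adj_irrefl inj path])
    show "2 \<le> l" using l by (cases "l = 1") auto
    show "(v 0, v l) \<in> {(a, b). adj a b \<and> a \<in> insert (v 0) (insert (v l) W)
                                          \<and> b \<in> insert (v 0) (insert (v l) W)}\<^sup>*"
      using conn by (simp add: R_def U_def)
    show "v i \<notin> W" if "i \<le> l" for i using W_lev lev[OF that] by fastforce
    show "\<not> adj w (v i)" if "w \<in> W" "0 < i" "i < l" for w i using anti that .
  qed auto
qed

text \<open>
  Each of the \<open>t\<close> rounds of thinning with \<open>D = 2 t\<close> costs at most \<open>4 t\<close> arcs per vertex, hence
  \<open>4 t\<^sup>2\<close> per vertex altogether, while the number of arcs is half the sum of the degrees.
\<close>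

lemma chordless_cycle_of_large_degrees:
  assumes t: "0 < t" and deg: "\<And>v. v \<in> V \<Longrightarrow> 8 * t * t < card {u. adj u v}"
  shows "\<exists>c m. 2 * t + 2 \<le> m \<and> chordless_cycle adj c m"
proof -
  have "8 * t * t * card C < (\<Sum>v\<in>C. card {u. adj u v})"
  proof -
    have "(\<Sum>v\<in>C. 8 * t * t) < (\<Sum>v\<in>C. card {u. adj u v})"
      using finite_component root_in_component deg component_subset
      by (intro sum_strict_mono) auto
    then show ?thesis by (simp add: mult.commute)
  qed
  then have "2 * (2 * t * (2 * t) * card C) < 2 * card down_arcs"
    unfolding sum_degree_eq by (simp add: algebra_simps)
  then have "arcs (2 * t) t \<noteq> {}"
    using card_down_arcs_le[of "2 * t" t] by auto
  then obtain v where "zigzag (2 * t) v"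
    using exists_zigzag[of "2 * t" t t] by auto
  then show ?thesis using chordless_cycle_of_zigzag[of "2 * t" v] t by simp
qed

end

end

section \<open>A vertex with a nearly known neighbourhood\<close>

text \<open>
  Without squares, degrees above the bound would give a chordless cycle of length at least
  \<open>2 (k + 1) + 2\<close>, by thinning for \<open>k + 1\<close> rounds, a positive number even for \<open>k = 0\<close>.
\<close>

lemma A_free_exists_close_vertex:
  fixes G :: "'a::wellorder ugraph"
  assumes G: "simple_graph G" "bipartite G" "free_of G graph_A"
    and chord: "chordality_at_most k G" and ne: "verts G \<noteq> {}"
  shows "(\<exists>u\<in>verts G. \<exists>v\<in>verts G. u \<noteq> v \<and> card (sym_diff (neighbours G v) (neighbours G u)) \<le> 2)
    \<or> (\<exists>v\<in>verts G. card (neighbours G v) \<le> 8 * (k + 1) * (k + 1))"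
proof -
  have V: "u \<in> verts G" "v \<in> verts G" if "{u, v} \<in> edges G" for u v
    using that G(1) unfolding simple_graph_def by blast+
  have fin: "finite (neighbours G v)" for v
    using V G(1) by (auto simp: neighbours_def simple_graph_def intro: finite_subset)
  obtain A where A: "\<And>u v. {u, v} \<in> edges G \<Longrightarrow> (u \<in> A) \<noteq> (v \<in> A)"
    using bipartite_colouring[OF G(2)] by blast
  consider (twins) u v where "u \<in> verts G" "v \<in> verts G" "u \<noteq> v" "neighbours G u = neighbours G v"
    | (square) u v a b where "\<And>u v. \<lbrakk>u \<in> verts G; v \<in> verts G; u \<noteq> v\<rbrakk> \<Longrightarrow> neighbours G u \<noteq> neighbours G v"
        "u \<noteq> v" "a \<noteq> b" "a \<in> neighbours G u \<inter> neighbours G v" "b \<in> neighbours G u \<inter> neighbours G v"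
    | (square_free) "\<And>u v a b. \<lbrakk>u \<noteq> v; a \<in> neighbours G u; a \<in> neighbours G v;
        b \<in> neighbours G u; b \<in> neighbours G v\<rbrakk> \<Longrightarrow> a = b"
    by (metis Int_iff)
  then show ?thesis
  proof cases
    case twins
    then show ?thesis by (intro disjI1 bexI[of _ u] bexI[of _ v]) auto
  next
    case square
    have small: "card (neighbours G p - neighbours G q) \<le> 1"
      if "{p, q} = {u, v}" for p q
    proof -
      have "a \<in> neighbours G p \<inter> neighbours G q" "b \<in> neighbours G p \<inter> neighbours G q"
        using that square by (auto simp: doubleton_eq_iff)
      then have "\<forall>c\<in>neighbours G p - neighbours G q. \<forall>c'\<in>neighbours G p - neighbours G q. c = c'"
        using A_free_twin_free_close[OF G square(1) square(3)] by blast
      then show ?thesis using fin by (simp add: card_le_Suc0_iff_eq)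
    qed
    have "card (sym_diff (neighbours G v) (neighbours G u)) \<le> 2"
      using small[of u v] small[of v u] card_Un_le[of "neighbours G v - neighbours G u" "neighbours G u - neighbours G v"]
      by (simp add: insert_commute)
    moreover have "u \<in> verts G" "v \<in> verts G"
      using square(4) V by (auto simp: neighbours_def)
    ultimately show ?thesis using square(2) by blast
  next
    case square_free
    have loc: "square_free_bipartite (verts G) (\<lambda>u v. {u, v} \<in> edges G) A"
    proof
      show "finite (verts G)" using G(1) by (simp add: simple_graph_def)
      show "a = b" if "u \<noteq> v" "{u, a} \<in> edges G" "{v, a} \<in> edges G" "{u, b} \<in> edges G" "{v, b} \<in> edges G"
        for u v a b
        using square_free[of u v a b] that by (simp add: neighbours_def insert_commute)
    qed (use V A in \<open>auto simp: insert_commute\<close>)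
    obtain r where r: "r \<in> verts G" using ne by blast
    have "\<exists>v\<in>verts G. card (neighbours G v) \<le> 8 * (k + 1) * (k + 1)"
    proof (rule ccontr)
      assume "\<not> ?thesis"
      then have deg: "8 * (k + 1) * (k + 1) < card {u. {u, v} \<in> edges G}" if "v \<in> verts G" for v
        using that unfolding neighbours_def by (meson not_le)
      obtain c m where m: "2 * (k + 1) + 2 \<le> m"
        and c: "chordless_cycle (\<lambda>u v. {u, v} \<in> edges G) c m"
        using square_free_bipartite.chordless_cycle_of_large_degrees[OF loc r, of "k + 1"] deg by auto
      have "c i \<in> verts G" if "i < m" for i
        using c that m V(1)[of "c i" "c (Suc i mod m)"] by (auto simp: chordless_cycle_def)
      then have "contains_induced G (cycle_graph m)"
        using contains_induced_cycle_graph[OF c] by auto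
      then show False using chord m by (simp add: chordality_at_most_def)
    qed
    then show ?thesis by blast
  qed
qed

section \<open>Heredity\<close>

lemma induced_subgraph_induced_subgraph:
  "T \<subseteq> S \<Longrightarrow> induced_subgraph (induced_subgraph G S) T = induced_subgraph G T"
  by (auto simp: induced_subgraph_def)

lemma contains_induced_induced_subgraph:
  assumes "contains_induced (induced_subgraph G S) H" "S \<subseteq> verts G"
  shows "contains_induced G H"
proof -
  obtain T where T: "T \<subseteq> S" "graph_iso (induced_subgraph (induced_subgraph G S) T) H"
    using assms(1) unfolding contains_induced_def by (auto simp: induced_subgraph_def)
  then show ?thesis
    using assms(2) unfolding contains_induced_def
    by (auto simp: induced_subgraph_induced_subgraph intro!: exI[of _ T])
qed

lemma bipartite_induced_subgraph:
  assumes "bipartite G" "S \<subseteq> verts G"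
  shows "bipartite (induced_subgraph G S)"
proof -
  obtain A B where AB: "A \<union> B = verts G" "A \<inter> B = {}" "\<And>e. e \<in> edges G \<Longrightarrow> \<exists>a\<in>A. \<exists>b\<in>B. e = {a, b}"
    using assms(1) unfolding bipartite_def by auto
  have "\<exists>a\<in>A \<inter> S. \<exists>b\<in>B \<inter> S. e = {a, b}" if "e \<in> edges G" "e \<subseteq> S" for e
    using AB(3)[OF that(1)] that(2) by blast
  then show ?thesis
    unfolding bipartite_def induced_subgraph_def using AB assms(2)
    by (intro exI[of _ "A \<inter> S"] exI[of _ "B \<inter> S"]) auto
qed

lemma hereditary_A_free_bipartite: "hereditary (A_free_bipartite k)"
  unfolding hereditary_def
proof (intro ballI allI impI)
  fix G S assume G: "G \<in> A_free_bipartite k" and S: "S \<subseteq> verts G"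
  have "simple_graph (induced_subgraph G S)"
    using G S by (auto simp: A_free_bipartite_def simple_graph_def induced_subgraph_def intro: finite_subset)
  moreover have "\<not> contains_induced (induced_subgraph G S) (cycle_graph m)"
    if "\<not> contains_induced G (cycle_graph m)" for m
    using contains_induced_induced_subgraph[OF _ S] that by blast
  moreover have "\<not> contains_induced (induced_subgraph G S) graph_A"
    using contains_induced_induced_subgraph[OF _ S, of graph_A] G
    by (auto simp: A_free_bipartite_def free_of_def)
  ultimately show "induced_subgraph G S \<in> A_free_bipartite k"
    using G bipartite_induced_subgraph[OF _ S]
    by (auto simp: A_free_bipartite_def chordality_at_most_def free_of_def)
qed

section \<open>Counting\<close>

text \<open>
  The neighbourhood of the new vertex \<open>v\<close> is encoded by \<open>u\<close> and \<open>xs\<close>, its symmetric difference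
  with the neighbourhood of \<open>u\<close> being the set of entries of \<open>xs\<close>. The vertex \<open>v\<close> itself serves as a
  dummy in both places: \<open>u = v\<close> stands for the empty neighbourhood, and the entries \<open>v\<close> of
  \<open>xs\<close> pad it to a fixed length.
\<close>

definition add_vertex :: "nat \<Rightarrow> nat \<times> nat list \<times> nat ugraph \<Rightarrow> nat ugraph" where
  "add_vertex v = (\<lambda>(u, xs, H). (insert v (verts H), edges H \<union>
     {{v, w} | w. w \<in> sym_diff (if u = v then {} else neighbours H u) (set xs - {v})}))"

lemma add_vertex_reconstructs:
  assumes G: "simple_graph G" and v: "v \<in> verts G" and u: "u \<in> verts G"
    and close: "card (sym_diff (neighbours G v) (if u = v then {} else neighbours G u)) \<le> c"
  obtains xs where "set xs \<subseteq> verts G" "length xs = c"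
    "G = add_vertex v (u, xs, induced_subgraph G (verts G - {v}))"
proof -
  define B where "B = (if u = v then {} else neighbours G u)"
  define T where "T = sym_diff (neighbours G v) B"
  define H where "H = induced_subgraph G (verts G - {v})"
  have V: "p \<in> verts G \<and> q \<in> verts G \<and> p \<noteq> q" if "{p, q} \<in> edges G" for p q
    using that G unfolding simple_graph_def by (force simp: card_2_iff doubleton_eq_iff)
  have T: "T \<subseteq> verts G" using V by (auto simp: T_def B_def neighbours_def)
  then have "finite T" using G finite_subset unfolding simple_graph_def by blast
  then obtain ys where ys: "set ys = T" "length ys = card T"
    using finite_distinct_list distinct_card by metis
  define xs where "xs = ys @ replicate (c - card T) v"
  have xs: "set xs \<subseteq> verts G" "length xs = c" "set xs - {v} = T - {v}"
    using ys T v close by (auto simp: xs_def T_def B_def)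
  have BH: "(if u = v then {} else neighbours H u) = B - {v}"
    using V by (auto simp: B_def H_def neighbours_def induced_subgraph_def)
  have N: "sym_diff (if u = v then {} else neighbours H u) (set xs - {v}) = neighbours G v"
  proof -
    have "v \<notin> neighbours G v" using V[of v v] by (auto simp: neighbours_def)
    then show ?thesis unfolding BH xs(3) by (auto simp: T_def)
  qed
  have "edges G = edges H \<union> {{v, w} | w. w \<in> neighbours G v}"
  proof (intro subset_antisym subsetI)
    fix e assume e: "e \<in> edges G"
    then obtain p q where pq: "e = {p, q}"
      using G unfolding simple_graph_def by (auto simp: card_2_iff)
    show "e \<in> edges H \<union> {{v, w} | w. w \<in> neighbours G v}"
    proof (cases "v \<in> e")
      case True
      then have "e = {v, p} \<or> e = {v, q}" using pq by auto
      then show ?thesis using e by (auto simp: neighbours_def insert_commute)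
    next
      case False
      then show ?thesis using e G unfolding simple_graph_def by (auto simp: H_def induced_subgraph_def)
    qed
  qed (auto simp: H_def induced_subgraph_def neighbours_def insert_commute)
  moreover have "verts G = insert v (verts H)" using v by (auto simp: H_def induced_subgraph_def)
  ultimately have "G = add_vertex v (u, xs, H)"
    unfolding add_vertex_def prod.case N by (simp add: prod_eq_iff)
  then show thesis using that xs(1,2) unfolding H_def by blast
qed

text \<open>
  A graph is determined by the vertex \<open>v\<close>, the code of its neighbourhood and the graph without \<open>v\<close>.
  There are at most \<open>N\<close> choices for \<open>v\<close>, \<open>N\<close> for \<open>u\<close> and \<open>N\<^sup>c\<close> for the list.
\<close>

lemma card_graphs_le:
  assumes her: "hereditary X"
    and close: "\<And>G. \<lbrakk>G \<in> X; simple_graph G; verts G \<noteq> {}\<rbrakk> \<Longrightarrow> \<exists>v\<in>verts G. \<exists>u\<in>verts G.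
        card (sym_diff (neighbours G v) (if u = v then {} else neighbours G u)) \<le> c"
  shows "\<lbrakk>finite V; card V \<le> N\<rbrakk> \<Longrightarrow> finite {G \<in> X. simple_graph G \<and> verts G = V} \<and>
    card {G \<in> X. simple_graph G \<and> verts G = V} \<le> N ^ ((c + 2) * card V)"
proof (induction "card V" arbitrary: V)
  case 0
  then have "V = {}" by simp
  have "{G \<in> X. simple_graph G \<and> verts G = V} \<subseteq> {({}, {})}"
    unfolding \<open>V = {}\<close> by (auto simp: simple_graph_def) (metis card.empty zero_neq_numeral)
  then have "finite {G \<in> X. simple_graph G \<and> verts G = V}"
    "card {G \<in> X. simple_graph G \<and> verts G = V} \<le> card {({}, {}) :: nat ugraph}"
    by (auto intro: finite_subset card_mono simp del: card.insert)
  then show ?case using 0 by simp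
next
  case (Suc n)
  define S where "S V = {G \<in> X. simple_graph G \<and> verts G = V}" for V
  define L where "L = {xs. set xs \<subseteq> V \<and> length xs = c}"
  have fin: "finite V" and n: "card V = Suc n" "Suc n \<le> N" using Suc by simp_all
  have L: "finite L" "card L = Suc n ^ c"
    using fin n by (simp_all add: L_def finite_lists_length_eq card_lists_length_eq)
  have IH: "finite (S (V - {v}))" "card (S (V - {v})) \<le> N ^ ((c + 2) * n)" if "v \<in> V" for v
    using Suc.hyps(1)[of "V - {v}"] that fin n by (simp_all add: S_def)
  have sub: "S V \<subseteq> (\<Union>v\<in>V. add_vertex v ` (V \<times> L \<times> S (V - {v})))"
  proof
    fix G assume "G \<in> S V"
    then have G: "G \<in> X" "simple_graph G" "verts G = V" by (auto simp: S_def)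
    moreover have "V \<noteq> {}" using n by auto
    ultimately obtain v u where v: "v \<in> verts G" and u: "u \<in> verts G"
      and "card (sym_diff (neighbours G v) (if u = v then {} else neighbours G u)) \<le> c"
      using close[of G] by auto
    then obtain xs where xs: "set xs \<subseteq> verts G" "length xs = c"
      "G = add_vertex v (u, xs, induced_subgraph G (verts G - {v}))"
      using add_vertex_reconstructs[OF G(2)] by blast
    have "induced_subgraph G (verts G - {v}) \<in> S (V - {v})"
      using her G unfolding hereditary_def S_def
      by (auto simp: simple_graph_def induced_subgraph_def)
    then have "(u, xs, induced_subgraph G (verts G - {v})) \<in> V \<times> L \<times> S (V - {v})"
      using u xs G(3) by (simp add: L_def)
    then show "G \<in> (\<Union>v\<in>V. add_vertex v ` (V \<times> L \<times> S (V - {v})))"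
      using xs(3) v G(3) by blast
  qed
  have finU: "finite (\<Union>v\<in>V. add_vertex v ` (V \<times> L \<times> S (V - {v})))"
    using fin L IH by auto
  have "card (S V) \<le> card (\<Union>v\<in>V. add_vertex v ` (V \<times> L \<times> S (V - {v})))"
    using sub finU by (rule card_mono[rotated])
  also have "\<dots> \<le> (\<Sum>v\<in>V. card (add_vertex v ` (V \<times> L \<times> S (V - {v}))))"
    by (rule card_UN_le[OF fin])
  also have "\<dots> \<le> (\<Sum>v\<in>V. Suc n * (Suc n ^ c * N ^ ((c + 2) * n)))"
  proof (rule sum_mono)
    fix v assume v: "v \<in> V"
    have "card (add_vertex v ` (V \<times> L \<times> S (V - {v}))) \<le> card (V \<times> L \<times> S (V - {v}))"
      using fin L IH[OF v] by (intro card_image_le) auto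
    also have "\<dots> = Suc n * (Suc n ^ c * card (S (V - {v})))"
      using n L by (simp only: card_cartesian_product)
    also have "\<dots> \<le> Suc n * (Suc n ^ c * N ^ ((c + 2) * n))"
      using IH[OF v] by (intro mult_le_mono le_refl) auto
    finally show "card (add_vertex v ` (V \<times> L \<times> S (V - {v}))) \<le> Suc n * (Suc n ^ c * N ^ ((c + 2) * n))" .
  qed
  also have "\<dots> = Suc n ^ (c + 2) * N ^ ((c + 2) * n)"
    using n by (simp only: sum_constant) (simp add: power_add power2_eq_square algebra_simps)
  also have "\<dots> \<le> N ^ (c + 2) * N ^ ((c + 2) * n)"
    using n by (intro mult_le_mono1 power_mono) auto
  also have "\<dots> = N ^ ((c + 2) * card V)"
    unfolding n(1) by (simp add: power_add algebra_simps)
  finally have "card (S V) \<le> N ^ ((c + 2) * card V)" .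
  moreover have "finite (S V)" using sub finU finite_subset by blast
  ultimately show ?case by (simp add: S_def)
qed

lemma at_most_factorialI:
  assumes her: "hereditary X"
    and close: "\<And>G. \<lbrakk>G \<in> X; simple_graph G; verts G \<noteq> {}\<rbrakk> \<Longrightarrow> \<exists>v\<in>verts G. \<exists>u\<in>verts G.
        card (sym_diff (neighbours G v) (if u = v then {} else neighbours G u)) \<le> c"
  shows "at_most_factorial X"
  unfolding at_most_factorial_def
proof (intro conjI exI[of _ "\<lambda>n. real (c + 2) / ln 2 * (real n * ln (real n))"] allI her)
  show "(\<lambda>n. real (c + 2) / ln 2 * (real n * ln (real n))) \<in> O(\<lambda>n. real n * ln (real n))"
    by simp
  fix n :: nat
  have "card (labelled_graphs X n) \<le> n ^ ((c + 2) * n)"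
    using card_graphs_le[OF her close, of "{1..n}" n] by (simp add: labelled_graphs_def)
  then have "real (card (labelled_graphs X n)) \<le> real n ^ ((c + 2) * n)"
    by (metis of_nat_le_iff of_nat_power)
  also have "\<dots> = 2 powr (real (c + 2) / ln 2 * (real n * ln (real n)))"
  proof (cases "n = 0")
    case False
    then have "real n ^ ((c + 2) * n) = exp (ln (real n) * real ((c + 2) * n))"
      by (simp add: powr_realpow[symmetric] powr_def mult.commute)
    then show ?thesis by (simp add: powr_def field_simps)
  qed simp
  finally show "real (card (labelled_graphs X n)) \<le> 2 powr (real (c + 2) / ln 2 * (real n * ln (real n)))" .
qed

theorem theorem9:
  fixes k :: nat
  shows "at_most_factorial (A_free_bipartite k)"
proof (rule at_most_factorialI[OF hereditary_A_free_bipartite, where c = "8 * (k + 1) * (k + 1)"])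
  fix G :: "nat ugraph" assume G: "G \<in> A_free_bipartite k" "verts G \<noteq> {}"
  consider u v where "u \<in> verts G" "v \<in> verts G" "u \<noteq> v"
      "card (sym_diff (neighbours G v) (neighbours G u)) \<le> 2"
    | v where "v \<in> verts G" "card (neighbours G v) \<le> 8 * (k + 1) * (k + 1)"
    using A_free_exists_close_vertex[of G k] G by (auto simp: A_free_bipartite_def)
  then show "\<exists>v\<in>verts G. \<exists>u\<in>verts G. card (sym_diff (neighbours G v)
      (if u = v then {} else neighbours G u)) \<le> 8 * (k + 1) * (k + 1)"
  proof cases
    case 1
    then show ?thesis by (intro bexI[of _ v] bexI[of _ u]) auto
  next
    case 2
    then show ?thesis by (intro bexI[of _ v] bexI[of _ v]) auto
  qed
qed

end
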